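(* Let $R$ be a commutative local ring, and let $V$ be a free $R$-module of rank $2m$ ($m\ge1$) with a nondegenerate alternating bilinear form $h:V\times V\to R$ admitting a symplectic basis $u_1,v_1,\dots,u_m,v_m$ (that is, the skew hermitian setting with trivial involution). Then $U(V)=Sp(V)=SU(V)$ is generated by the set of all symplectic transvections $f_{a,v}$, where $a\in R$ and $v\in V$ is a basis vector. In particular, every symplectic transformation of $V$ has determinant $1$.
   Context: $Sp(V)$ is the group of $R$-linear automorphisms $g$ of $V$ with $h(gu,gv)=h(u,v)$ for all $u,v\in V$; with trivial involution this is the same as the unitary group $U(V)$ of $h$. $SU(V)$ is its subgroup of elements of determinant $1$. A basis $u_1,v_1,\dots,u_m,v_m$ is symplectic if $h(u_i,v_i)=1$, $h(u_i,u_j)=h(v_i,v_j)=0$ for all $i,j$, and $h(u_i,v_j)=0$ for $i\neq j$. A vector of $V$ is a basis vector if it belongs to some $R$-basis of $V$. For $a\in R$, $v\in V$, $f_{a,v}(u)=u+a\,h(v,u)\,v$. *)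

theory Defs
  imports
    "HOL-Algebra.Ideal"
    "HOL-Algebra.Generated_Groups"
    "Jordan_Normal_Form.Determinant"
begin

text \<open>The ring \<open>R\<close> is a type of class \<^class>\<open>comm_ring_1\<close>, and an \<open>R\<close>-module \<open>V\<close> is a type of
  class \<^class>\<open>ab_group_add\<close> with a scalar multiplication \<open>s\<close> satisfying the locale
  \<^locale>\<open>Modules.module\<close> (the theory \<open>HOL-Algebra.Module\<close> has another locale of that name).
  Ideals and generated subgroups are those of \<open>HOL-Algebra\<close>.\<close>

definition ring_of_type :: "'a::comm_ring_1 itself \<Rightarrow> 'a ring" where
  "ring_of_type _ = \<lparr>carrier = UNIV, monoid.mult = (*), one = 1, zero = 0, add = (+)\<rparr>"

definition local_ring :: "'a::comm_ring_1 itself \<Rightarrow> bool" where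
  "local_ring A \<longleftrightarrow> (\<exists>!I. maximalideal I (ring_of_type A))"


subsection \<open>Bases and determinants\<close>

definition is_basis :: "('a::comm_ring_1 \<Rightarrow> 'v::ab_group_add \<Rightarrow> 'v) \<Rightarrow> 'v set \<Rightarrow> bool" where
  "is_basis s B \<longleftrightarrow> \<not> Modules.module.dependent s B \<and> Modules.module.span s B = UNIV"

definition ordered_basis :: "('a::comm_ring_1 \<Rightarrow> 'v::ab_group_add \<Rightarrow> 'v) \<Rightarrow> 'v list \<Rightarrow> bool" where
  "ordered_basis s bs \<longleftrightarrow> distinct bs \<and> is_basis s (set bs)"

definition free_of_rank :: "('a::comm_ring_1 \<Rightarrow> 'v::ab_group_add \<Rightarrow> 'v) \<Rightarrow> nat \<Rightarrow> bool" where
  "free_of_rank s n \<longleftrightarrow> Modules.module s \<and> (\<exists>bs. ordered_basis s bs \<and> length bs = n)"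

definition basis_vector :: "('a::comm_ring_1 \<Rightarrow> 'v::ab_group_add \<Rightarrow> 'v) \<Rightarrow> 'v \<Rightarrow> bool" where
  "basis_vector s v \<longleftrightarrow> (\<exists>B. is_basis s B \<and> v \<in> B)"

text \<open>Column \<open>j\<close> holds the coordinates of the image of the \<open>j\<close>-th basis vector.\<close>

definition matrix_of ::
  "('a::comm_ring_1 \<Rightarrow> 'v::ab_group_add \<Rightarrow> 'v) \<Rightarrow> 'v list \<Rightarrow> ('v \<Rightarrow> 'v) \<Rightarrow> 'a mat" where
  "matrix_of s bs g = mat (length bs) (length bs)
     (\<lambda>(i, j). Modules.module.representation s (set bs) (g (bs ! j)) (bs ! i))"

text \<open>The description is meaningful because the determinant of the matrix of an endomorphism of a
  free module of finite rank does not depend on the basis; on other modules the value is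
  unspecified.\<close>

definition endo_det :: "('a::comm_ring_1 \<Rightarrow> 'v::ab_group_add \<Rightarrow> 'v) \<Rightarrow> ('v \<Rightarrow> 'v) \<Rightarrow> 'a" where
  "endo_det s g = (THE d. \<exists>bs. ordered_basis s bs \<and> d = det (matrix_of s bs g))"


subsection \<open>Forms\<close>

definition bilinear_form ::
  "('a::comm_ring_1 \<Rightarrow> 'v::ab_group_add \<Rightarrow> 'v) \<Rightarrow> ('v \<Rightarrow> 'v \<Rightarrow> 'a) \<Rightarrow> bool" where
  "bilinear_form s h \<longleftrightarrow>
     (\<forall>u. Modules.module_hom s (*) (\<lambda>v. h u v)) \<and> (\<forall>v. Modules.module_hom s (*) (\<lambda>u. h u v))"

definition alternating_form ::
  "('a::comm_ring_1 \<Rightarrow> 'v::ab_group_add \<Rightarrow> 'v) \<Rightarrow> ('v \<Rightarrow> 'v \<Rightarrow> 'a) \<Rightarrow> bool" where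
  "alternating_form s h \<longleftrightarrow> bilinear_form s h \<and> (\<forall>v. h v v = 0)"

text \<open>Nondegeneracy over a ring: \<open>v \<mapsto> h(v, -)\<close> is an isomorphism of \<open>V\<close> onto its dual module
  (not merely injective).\<close>

definition nondegenerate ::
  "('a::comm_ring_1 \<Rightarrow> 'v::ab_group_add \<Rightarrow> 'v) \<Rightarrow> ('v \<Rightarrow> 'v \<Rightarrow> 'a) \<Rightarrow> bool" where
  "nondegenerate s h \<longleftrightarrow> bij_betw h UNIV {\<phi>. Modules.module_hom s (*) \<phi>}"

text \<open>The vectors \<open>u\<^sub>1, v\<^sub>1, \<dots>, u\<^sub>m, v\<^sub>m\<close> are indexed from \<open>0\<close> to \<open>m - 1\<close>.\<close>

definition symplectic_basis ::
  "('a::comm_ring_1 \<Rightarrow> 'v::ab_group_add \<Rightarrow> 'v) \<Rightarrow> ('v \<Rightarrow> 'v \<Rightarrow> 'a) \<Rightarrow> nat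
     \<Rightarrow> (nat \<Rightarrow> 'v) \<Rightarrow> (nat \<Rightarrow> 'v) \<Rightarrow> bool" where
  "symplectic_basis s h m u v \<longleftrightarrow>
     ordered_basis s (concat (map (\<lambda>i. [u i, v i]) [0..<m])) \<and>
     (\<forall>i<m. h (u i) (v i) = 1) \<and>
     (\<forall>i<m. \<forall>j<m. h (u i) (u j) = 0 \<and> h (v i) (v j) = 0) \<and>
     (\<forall>i<m. \<forall>j<m. i \<noteq> j \<longrightarrow> h (u i) (v j) = 0)"


subsection \<open>Groups\<close>

definition GL :: "('a::comm_ring_1 \<Rightarrow> 'v::ab_group_add \<Rightarrow> 'v) \<Rightarrow> ('v \<Rightarrow> 'v) monoid" where
  "GL s = \<lparr>carrier = {g. Modules.module_hom s s g \<and> bij g}, monoid.mult = (\<circ>), one = id\<rparr>"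

text \<open>The isometry group of an arbitrary form; the involution only enters the axioms for \<open>h\<close>.\<close>

definition unitary_group ::
  "('a::comm_ring_1 \<Rightarrow> 'v::ab_group_add \<Rightarrow> 'v) \<Rightarrow> ('v \<Rightarrow> 'v \<Rightarrow> 'a) \<Rightarrow> ('v \<Rightarrow> 'v) set" where
  "unitary_group s h = {g \<in> carrier (GL s). \<forall>u v. h (g u) (g v) = h u v}"

text \<open>For trivial involution this is by definition the same group as the unitary group.\<close>

definition symplectic_group ::
  "('a::comm_ring_1 \<Rightarrow> 'v::ab_group_add \<Rightarrow> 'v) \<Rightarrow> ('v \<Rightarrow> 'v \<Rightarrow> 'a) \<Rightarrow> ('v \<Rightarrow> 'v) set" where
  "symplectic_group s h = {g \<in> carrier (GL s). \<forall>u v. h (g u) (g v) = h u v}"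

definition special_unitary_group ::
  "('a::comm_ring_1 \<Rightarrow> 'v::ab_group_add \<Rightarrow> 'v) \<Rightarrow> ('v \<Rightarrow> 'v \<Rightarrow> 'a) \<Rightarrow> ('v \<Rightarrow> 'v) set" where
  "special_unitary_group s h = {g \<in> unitary_group s h. endo_det s g = 1}"

definition transvection ::
  "('a::comm_ring_1 \<Rightarrow> 'v::ab_group_add \<Rightarrow> 'v) \<Rightarrow> ('v \<Rightarrow> 'v \<Rightarrow> 'a) \<Rightarrow> 'a \<Rightarrow> 'v \<Rightarrow> 'v \<Rightarrow> 'v" where
  "transvection s h a v u = u + s (a * h v u) v"

end

theory Submission
  imports Defs "HOL-Algebra.Ring_Divisibility"
begin

text \<open>
  Call a vector \<open>v\<close> unimodular if \<open>h v w\<close> is a unit for some \<open>w\<close>. The proof works with the group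
  generated by the transvections \<open>f\<^bsub>a,v\<^esub>\<close> with \<open>v\<close> unimodular; basis vectors enter only at the end.

  If \<open>h x y\<close> is a unit, the transvection along \<open>y - x\<close> with parameter \<open>- 1 / h x y\<close> sends \<open>x\<close>
  to \<open>y\<close>, and it fixes everything orthogonal to \<open>y - x\<close> (\<open>reachable_by_transvection\<close>). If \<open>h x y\<close>
  is not a unit but \<open>x\<close> and \<open>y\<close> belong to hyperbolic pairs, two such steps through an intermediate
  vector suffice; it exists
  because in a local ring one summand of a unit is a unit. Hence, for any set \<open>E\<close>, the
  group elements fixing \<open>E\<close> pointwise act transitively on the hyperbolic pairs orthogonal to \<open>E\<close>
  (\<open>hyperbolic_pair_transitive\<close>). A symplectic map can therefore be corrected by generators
  so that it fixes the pairs \<open>(u\<^sub>i, v\<^sub>i)\<close> of a symplectic basis one after the other, until it is the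
  identity (\<open>symplectic_group_subset_unimodular_transvection_group\<close>).

  The same transitivity, with \<open>E\<close> empty, moves the first vector of the symplectic basis to any given
  unimodular vector. An automorphism maps bases to bases, so unimodular vectors are basis vectors
  (\<open>basis_vector_if_unimodular\<close>).

  For the determinant, the matrix of a transvection in any ordered basis has the form \<open>1 + X Y\<close> with a
  column \<open>X\<close>, a row \<open>Y\<close>, and \<open>Y X = a * h v v = 0\<close>; so its determinant is \<open>1 + Y X = 1\<close>
  (\<open>det_one_plus_col_mult_row\<close>, \<open>det_transvection\<close>). Since matrices multiply under composition, every
  symplectic map has determinant \<open>1\<close> in every ordered basis, and this common value is what
  \<open>endo_det\<close> describes.
\<close>

section \<open>Units of a local ring\<close>

lemma cring_ring_of_type: "cring (ring_of_type TYPE('a::comm_ring_1))"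
proof (rule cringI)
  show "abelian_group (ring_of_type TYPE('a))"
  proof (rule abelian_groupI)
    fix x assume "x \<in> carrier (ring_of_type TYPE('a))"
    show "\<exists>y\<in>carrier (ring_of_type TYPE('a)).
        y \<oplus>\<^bsub>ring_of_type TYPE('a)\<^esub> x = \<zero>\<^bsub>ring_of_type TYPE('a)\<^esub>"
      by (rule bexI[of _ "- x"]) (simp_all add: ring_of_type_def)
  qed (simp_all add: ring_of_type_def algebra_simps)
  show "comm_monoid (ring_of_type TYPE('a))"
    by (rule comm_monoidI) (simp_all add: ring_of_type_def algebra_simps)
qed (simp_all add: ring_of_type_def algebra_simps)

text \<open>Zorn's lemma is applied to the ideals that contain \<open>a\<close> and avoid \<open>1\<close>; the principal ideal of
  \<open>a\<close> is one of them because \<open>a\<close> is not a unit.\<close>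

lemma nonunit_in_maximalideal:
  fixes a :: "'a::comm_ring_1"
  assumes "\<not> a dvd 1"
  obtains M where "maximalideal M (ring_of_type TYPE('a))" "a \<in> M"
proof -
  define R where "R = ring_of_type TYPE('a)"
  interpret R: cring R unfolding R_def by (rule cring_ring_of_type)
  have R_simps: "carrier R = UNIV" "\<one>\<^bsub>R\<^esub> = 1" "x \<otimes>\<^bsub>R\<^esub> y = x * y" for x y
    by (simp_all add: R_def ring_of_type_def)
  define \<A> where "\<A> = {I. ideal I R \<and> a \<in> I \<and> 1 \<notin> I}"
  have "PIdl\<^bsub>R\<^esub> a \<in> \<A>"
    using R.cgenideal_ideal[of a] R.cgenideal_self[of a] assms
    by (auto simp: \<A>_def cgenideal_def R_simps dvd_def mult.commute)
  moreover have "\<Union>\<C> \<in> \<A>" if "\<C> \<noteq> {}" "subset.chain \<A> \<C>" for \<C>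
  proof -
    have "subset.chain {I. ideal I R} \<C>"
      using that(2) by (auto simp: pred_on.chain_def \<A>_def)
    from R.chain_Union_is_ideal[OF this] that show ?thesis
      by (auto simp: pred_on.chain_def \<A>_def)
  qed
  ultimately obtain M where M: "M \<in> \<A>" and max: "\<And>I. I \<in> \<A> \<Longrightarrow> M \<subseteq> I \<Longrightarrow> I = M"
    using subset_Zorn_nonempty[of \<A>] by blast
  have "maximalideal M R"
  proof (rule maximalidealI)
    show "ideal M R" "carrier R \<noteq> M" using M by (auto simp: \<A>_def R_simps)
    show "J = M \<or> J = carrier R" if J: "ideal J R" "M \<subseteq> J" for J
      using max[of J] J M ideal.one_imp_carrier[OF J(1)] by (auto simp: \<A>_def R_simps)
  qed
  with M that show thesis by (auto simp: \<A>_def R_def)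
qed

text \<open>Two nonunits lie in the same, unique maximal ideal, so their sum lies there too and cannot be
  a unit.\<close>

lemma local_ring_unit_add:
  fixes a b :: "'a::comm_ring_1"
  assumes "local_ring TYPE('a)" and "a + b dvd 1"
  shows "a dvd 1 \<or> b dvd 1"
proof (rule ccontr)
  assume *: "\<not> (a dvd 1 \<or> b dvd 1)"
  obtain M where M: "maximalideal M (ring_of_type TYPE('a))" "a \<in> M"
    using nonunit_in_maximalideal * by blast
  obtain N where "maximalideal N (ring_of_type TYPE('a))" "b \<in> N"
    using nonunit_in_maximalideal * by blast
  with M assms(1) have b: "b \<in> M" by (auto simp: local_ring_def)
  interpret maximalideal M "ring_of_type TYPE('a)" by (fact M(1))
  have "a + b \<in> M"
    using additive_subgroup.a_closed[OF is_additive_subgroup M(2) b] by (simp add: ring_of_type_def)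
  moreover obtain c where "1 = (a + b) * c" using assms(2) by (auto simp: dvd_def)
  ultimately have "1 \<in> M"
    using I_r_closed[of "a + b" c] by (simp add: ring_of_type_def)
  then have "carrier (ring_of_type TYPE('a)) = M"
    using one_imp_carrier by (simp add: ring_of_type_def)
  with I_notcarr show False by simp
qed


section \<open>The determinant of a rank-one perturbation of the identity\<close>

text \<open>The matrix determinant lemma. The bordered matrix \<open>M\<close> with rows \<open>(1, X)\<close> and \<open>(- Y, 1)\<close> can be
  cleared by unipotent block matrices in two ways: \<open>P M\<close> is block lower triangular with diagonal
  \<open>1 + X Y, 1\<close>, and \<open>M = L U\<close> with \<open>U\<close> block upper triangular with diagonal \<open>1, 1 + Y X\<close>. As no
  inverses occur, this is valid over every commutative ring.\<close>

lemma det_one_plus_col_mult_row: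
  fixes X Y :: "'a::comm_ring_1 mat"
  assumes X: "X \<in> carrier_mat n 1" and Y: "Y \<in> carrier_mat 1 n"
  shows "det (1\<^sub>m n + X * Y) = 1 + (Y * X) $$ (0, 0)"
proof -
  let ?D = "1\<^sub>m 1 + Y * X"
  let ?P = "four_block_mat (1\<^sub>m n) (- X) (0\<^sub>m 1 n) (1\<^sub>m 1)"
  let ?M = "four_block_mat (1\<^sub>m n) X (- Y) (1\<^sub>m 1)"
  let ?L = "four_block_mat (1\<^sub>m n) (0\<^sub>m n 1) (- Y) (1\<^sub>m 1)"
  let ?U = "four_block_mat (1\<^sub>m n) X (0\<^sub>m 1 n) ?D"
  have carr: "?P \<in> carrier_mat (n + 1) (n + 1)" "?M \<in> carrier_mat (n + 1) (n + 1)"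
    "?L \<in> carrier_mat (n + 1) (n + 1)" "?U \<in> carrier_mat (n + 1) (n + 1)"
    using X Y by (auto intro!: four_block_carrier_mat)
  have "?P * ?M = four_block_mat (1\<^sub>m n + X * Y) (0\<^sub>m n 1) (- Y) (1\<^sub>m 1)"
    using X Y by (subst mult_four_block_mat[of _ n n _ 1 _ 1 _ _ n _ 1])
      (auto intro!: cong_four_block_mat eq_matI)
  then have "det ?P * det ?M = det (1\<^sub>m n + X * Y)"
    using X Y det_mult[OF carr(1,2)]
      det_four_block_mat_upper_right_zero_col[of "1\<^sub>m n + X * Y" n "0\<^sub>m n 1" "- Y" "1\<^sub>m 1"]
    by auto
  moreover have "?L * ?U = ?M"
    using X Y by (subst mult_four_block_mat[of _ n n _ 1 _ 1 _ _ n _ 1])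
      (auto intro!: cong_four_block_mat eq_matI)
  then have "det ?L * det ?U = det ?M"
    using det_mult[OF carr(3,4)] by simp
  moreover have "det ?L = 1"
    using det_four_block_mat_upper_right_zero_col[of "1\<^sub>m n" n "0\<^sub>m n 1" "- Y" "1\<^sub>m 1"] Y by auto
  moreover have "det ?P = 1"
  proof -
    have "upper_triangular ?P" by (auto simp: upper_triangular_def)
    then have "det ?P = prod_list (diag_mat ?P)" by (rule det_upper_triangular[OF _ carr(1)])
    also have "diag_mat ?P = replicate n 1 @ [1]"
      by (rule nth_equalityI) (auto simp: diag_mat_def nth_append)
    finally show ?thesis by simp
  qed
  moreover have "det ?U = 1 + (Y * X) $$ (0, 0)"
  proof -
    have "upper_triangular ?U" using X Y by (auto simp: upper_triangular_def)
    then have "det ?U = prod_list (diag_mat ?U)" by (rule det_upper_triangular[OF _ carr(4)])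
    also have "diag_mat ?U = replicate n 1 @ [1 + (Y * X) $$ (0, 0)]"
      by (rule nth_equalityI) (use X Y in \<open>auto simp: diag_mat_def nth_append\<close>)
    finally show ?thesis by simp
  qed
  ultimately show ?thesis by simp
qed

section \<open>Automorphisms and their matrices\<close>

context Modules.module
begin

lemma ordered_basis_expand:
  assumes "ordered_basis scale bs"
  shows "(\<Sum>i<length bs. scale (representation (set bs) v (bs ! i)) (bs ! i)) = v"
proof -
  have "(\<Sum>i<length bs. scale (representation (set bs) v (bs ! i)) (bs ! i))
      = (\<Sum>b\<in>set bs. scale (representation (set bs) v b) b)"
    using assms by (intro sum.reindex_bij_betw bij_betw_nth) (auto simp: ordered_basis_def)
  also have "\<dots> = v"
    using assms by (intro sum_representation_eq) (auto simp: ordered_basis_def is_basis_def)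
  finally show ?thesis .
qed

lemma matrix_of_comp:
  assumes bs: "ordered_basis scale bs" and f: "Modules.module_hom scale scale f"
  shows "matrix_of scale bs (f \<circ> g) = matrix_of scale bs f * matrix_of scale bs g"
proof (rule eq_matI, goal_cases)
  case (1 i j)
  interpret f: Modules.module_hom scale scale f by fact
  define r where "r = representation (set bs)"
  let ?b = "\<lambda>i. bs ! i"
  have basis: "independent (set bs)" "\<And>v. v \<in> span (set bs)"
    using bs by (auto simp: ordered_basis_def is_basis_def)
  from 1 have ij: "i < length bs" "j < length bs" by (auto simp: matrix_of_def)
  have "f (g (?b j)) = (\<Sum>k<length bs. scale (r (g (?b j)) (?b k)) (f (?b k)))"
    by (subst ordered_basis_expand[OF bs, of "g (?b j)", symmetric])
       (simp add: f.sum f.scale r_def)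
  then have "r (f (g (?b j))) (?b i) = (\<Sum>k<length bs. r (g (?b j)) (?b k) * r (f (?b k)) (?b i))"
    by (simp add: r_def representation_sum representation_scale basis)
  with ij show ?case
    by (simp add: matrix_of_def scalar_prod_def r_def mult.commute atLeast0LessThan)
qed (simp_all add: matrix_of_def)

lemma matrix_of_id:
  assumes "ordered_basis scale bs"
  shows "matrix_of scale bs id = 1\<^sub>m (length bs)"
  using assms by (intro eq_matI)
    (auto simp: matrix_of_def ordered_basis_def is_basis_def representation_basis nth_eq_iff_index_eq)

lemma group_GL: "group (GL scale)"
proof (rule groupI)
  fix f assume "f \<in> carrier (GL scale)"
  then have f: "Modules.module_hom scale scale f" "bij f" by (auto simp: GL_def)
  interpret f: Modules.module_hom scale scale f by fact
  have "Modules.module_hom scale scale (inv_into UNIV f)"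
    using f(2) by unfold_locales (metis bij_inv_eq_iff f.add, metis bij_inv_eq_iff f.scale)
  then show "\<exists>g\<in>carrier (GL scale). g \<otimes>\<^bsub>GL scale\<^esub> f = \<one>\<^bsub>GL scale\<^esub>"
    using f(2) by (intro bexI[of _ "inv_into UNIV f"]) (auto simp: GL_def bij_is_inj bij_imp_bij_inv)
qed (auto simp: GL_def intro: bij_comp Modules.module_hom_compose module_hom_id)

lemma subgroup_symplectic_group: "subgroup (symplectic_group scale h) (GL scale)"
proof -
  interpret G: group "GL scale" by (rule group_GL)
  show ?thesis
  proof (rule G.subgroupI)
    show "symplectic_group scale h \<noteq> {}"
      using G.one_closed by (auto simp: symplectic_group_def GL_def)
    fix f assume f: "f \<in> symplectic_group scale h"
    define g where "g = inv\<^bsub>GL scale\<^esub> f"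
    have f': "f \<in> carrier (GL scale)" using f by (simp add: symplectic_group_def)
    then have g: "g \<in> carrier (GL scale)" unfolding g_def by (rule G.inv_closed)
    have fg: "f (g x) = x" for x
      using fun_cong[OF G.r_inv[OF f'], of x] by (simp add: g_def[symmetric]) (simp add: GL_def)
    have "h (g u) (g v) = h u v" for u v
    proof -
      have "h (f (g u)) (f (g v)) = h (g u) (g v)" using f by (simp add: symplectic_group_def)
      then show ?thesis by (simp add: fg)
    qed
    with g show "inv\<^bsub>GL scale\<^esub> f \<in> symplectic_group scale h"
      by (auto simp: symplectic_group_def g_def)
  next
    fix f g assume "f \<in> symplectic_group scale h" "g \<in> symplectic_group scale h"
    then show "f \<otimes>\<^bsub>GL scale\<^esub> g \<in> symplectic_group scale h"
      using G.m_closed[of f g] by (auto simp: symplectic_group_def GL_def)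
  qed (auto simp: symplectic_group_def)
qed

text \<open>Determinant \<open>1\<close> in the basis \<open>bs\<close> passes from generators to the whole group that they
  generate. As \<open>endo_det\<close> describes a value common to all ordered bases, \<open>bs\<close> is arbitrary.\<close>

lemma subgroup_det_eq_1:
  assumes bs: "ordered_basis scale bs"
  shows "subgroup {g \<in> carrier (GL scale). det (matrix_of scale bs g) = 1} (GL scale)"
proof -
  interpret G: group "GL scale" by (rule group_GL)
  have carr: "matrix_of scale bs g \<in> carrier_mat (length bs) (length bs)" for g
    by (simp add: matrix_of_def)
  have det_comp: "det (matrix_of scale bs (f \<otimes>\<^bsub>GL scale\<^esub> g))
      = det (matrix_of scale bs f) * det (matrix_of scale bs g)" if "f \<in> carrier (GL scale)" for f g
    using that matrix_of_comp[OF bs, of f g] det_mult[OF carr carr] by (auto simp: GL_def)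
  have det_one: "det (matrix_of scale bs \<one>\<^bsub>GL scale\<^esub>) = 1"
    using matrix_of_id[OF bs] by (simp add: GL_def)
  show ?thesis
  proof (rule G.subgroupI)
    show "{g \<in> carrier (GL scale). det (matrix_of scale bs g) = 1} \<noteq> {}"
      using det_one G.one_closed by blast
    fix g assume "g \<in> {g \<in> carrier (GL scale). det (matrix_of scale bs g) = 1}"
    then show "inv\<^bsub>GL scale\<^esub> g \<in> {g \<in> carrier (GL scale). det (matrix_of scale bs g) = 1}"
      using det_comp[of g "inv\<^bsub>GL scale\<^esub> g"] det_one by auto
  qed (auto simp: det_comp)
qed

lemma is_basis_image:
  assumes f: "f \<in> carrier (GL scale)" and B: "is_basis scale B"
  shows "is_basis scale (f ` B)"
proof -
  interpret f: Modules.module_hom scale scale f using f by (simp add: GL_def)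
  have "bij f" using f by (simp add: GL_def)
  then show ?thesis
    using B f.independent_inj_image[of B] f.span_image[of B]
    by (auto simp: is_basis_def bij_is_inj bij_is_surj)
qed

end

section \<open>Transvections\<close>

locale alternating_module = Modules.module s
  for s :: "'a::comm_ring_1 \<Rightarrow> 'v::ab_group_add \<Rightarrow> 'v" (infixr \<open>*s\<close> 75) +
  fixes h :: "'v \<Rightarrow> 'v \<Rightarrow> 'a"
  assumes alternating: "alternating_form s h"
begin

lemma form_hom: "Modules.module_hom s (*) (h u)" "Modules.module_hom s (*) (\<lambda>u. h u v)"
  using alternating by (auto simp: alternating_form_def bilinear_form_def)

lemmas form_simps =
  Modules.module_hom.add[OF form_hom(1)] Modules.module_hom.add[OF form_hom(2)]
  Modules.module_hom.diff[OF form_hom(1)] Modules.module_hom.diff[OF form_hom(2)]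
  Modules.module_hom.scale[OF form_hom(1)] Modules.module_hom.scale[OF form_hom(2)]

lemma form_self [simp]: "h u u = 0"
  using alternating by (simp add: alternating_form_def)

lemma form_skew: "h v u = - h u v"
  using form_self[of "u + v"] unfolding form_simps
  by (simp add: eq_neg_iff_add_eq_0 add.commute)

lemma transvection_hom: "Modules.module_hom s s (transvection s h a v)"
  by unfold_locales (simp_all add: transvection_def form_simps algebra_simps)

lemma transvection_comp: "transvection s h a v \<circ> transvection s h b v = transvection s h (a + b) v"
  by (rule ext) (simp add: transvection_def form_simps algebra_simps)

lemma transvection_0: "transvection s h 0 v = id"
  by (rule ext) (simp add: transvection_def)

lemma transvection_in_symplectic_group: "transvection s h a v \<in> symplectic_group s h"
proof -
  have "bij (transvection s h a v)"
    by (rule o_bij[where g = "transvection s h (- a) v"])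
       (simp_all add: transvection_comp transvection_0)
  moreover have "h (transvection s h a v x) (transvection s h a v y) = h x y" for x y
    using form_skew[of v x] by (simp add: transvection_def form_simps algebra_simps)
  ultimately show ?thesis
    using transvection_hom by (simp add: symplectic_group_def GL_def)
qed

text \<open>With \<open>X\<close> the coordinate column of \<open>v\<close> and \<open>Y\<close> the row of the values of \<open>a * h v _\<close> on the basis,
  the matrix is \<open>1 + X Y\<close>, and \<open>Y X\<close> is \<open>a * h v v\<close>, which vanishes as \<open>h\<close> is alternating.\<close>

lemma det_transvection:
  assumes bs: "ordered_basis s bs"
  shows "det (matrix_of s bs (transvection s h a v)) = 1"
proof -
  define n where "n = length bs"
  define r where "r = representation (set bs) v"
  define X where "X = mat n 1 (\<lambda>(i, _). r (bs ! i))"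
  define Y where "Y = mat 1 n (\<lambda>(_, j). a * h v (bs ! j))"
  have basis: "independent (set bs)" "\<And>v. v \<in> span (set bs)" "distinct bs"
    using bs by (auto simp: ordered_basis_def is_basis_def)
  have "matrix_of s bs (transvection s h a v) = 1\<^sub>m n + X * Y"
    using basis by (intro eq_matI)
      (auto simp: matrix_of_def X_def Y_def n_def r_def transvection_def representation_add
        representation_scale representation_basis nth_eq_iff_index_eq scalar_prod_def mult.commute)
  also have "det \<dots> = 1 + (Y * X) $$ (0, 0)"
    by (rule det_one_plus_col_mult_row) (simp_all add: X_def Y_def)
  also have "(Y * X) $$ (0, 0) = (\<Sum>i<n. a * h v (bs ! i) * r (bs ! i))"
    by (simp add: X_def Y_def scalar_prod_def atLeast0LessThan)
  also have "\<dots> = a * h v (\<Sum>i<n. r (bs ! i) *s bs ! i)"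
    by (simp add: Modules.module_hom.sum[OF form_hom(1)] form_simps sum_distrib_left algebra_simps)
  also have "\<dots> = 0"
    using ordered_basis_expand[OF bs, of v] by (simp add: n_def r_def)
  finally show ?thesis by simp
qed

definition orth :: "'v set \<Rightarrow> 'v set" where
  "orth E = {w. \<forall>e\<in>E. h w e = 0}"

text \<open>Unimodularity of the axis replaces the property of being a basis vector: it can be read off from
  the form, which is all that the transitivity arguments know about the axes they use.\<close>

definition unimodular_transvection_group :: "('v \<Rightarrow> 'v) set" where
  "unimodular_transvection_group =
     generate (GL s) {transvection s h a v | a v. \<exists>w. h v w dvd 1}"

text \<open>Fixing \<open>E\<close> pointwise plays the role of acting on the orthogonal complement of \<open>E\<close>. An induction
  on the rank can thus be run inside the single module \<open>V\<close>, by enlarging \<open>E\<close>.\<close>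

definition reachable :: "'v set \<Rightarrow> 'v \<Rightarrow> 'v \<Rightarrow> bool" where
  "reachable E x y \<longleftrightarrow> (\<exists>t\<in>unimodular_transvection_group. (\<forall>e\<in>E. t e = e) \<and> t x = y)"

lemma subgroup_unimodular_transvection_group: "subgroup unimodular_transvection_group (GL s)"
  unfolding unimodular_transvection_group_def
  using transvection_in_symplectic_group
  by (intro group.generate_is_subgroup group_GL) (auto simp: symplectic_group_def)

lemma unimodular_transvection_group_comp:
  assumes "f \<in> unimodular_transvection_group" "g \<in> unimodular_transvection_group"
  shows "f \<circ> g \<in> unimodular_transvection_group"
  using subgroup.m_closed[OF subgroup_unimodular_transvection_group assms] by (simp add: GL_def)

lemma unimodular_transvection_group_subset: "unimodular_transvection_group \<subseteq> symplectic_group s h"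
  unfolding unimodular_transvection_group_def
  using transvection_in_symplectic_group
  by (intro group.generate_subgroup_incl group_GL subgroup_symplectic_group) auto

lemma fixing_isometry_preserves_orth:
  assumes "f \<in> symplectic_group s h" "\<forall>e\<in>E. f e = e" "y \<in> orth E"
  shows "f y \<in> orth E"
proof -
  have "h (f y) e = 0" if "e \<in> E" for e
  proof -
    have "h (f y) e = h (f y) (f e)" using assms(2) that by simp
    also have "\<dots> = h y e" using assms(1) by (simp add: symplectic_group_def)
    finally show ?thesis using assms(3) that by (simp add: orth_def)
  qed
  then show ?thesis by (simp add: orth_def)
qed

lemma reachable_trans:
  assumes "reachable E x y" "reachable E y z"
  shows "reachable E x z"
proof -
  obtain f g where "f \<in> unimodular_transvection_group" "\<forall>e\<in>E. f e = e" "f x = y"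
    "g \<in> unimodular_transvection_group" "\<forall>e\<in>E. g e = e" "g y = z"
    using assms unfolding reachable_def by blast
  then show ?thesis
    unfolding reachable_def
    by (intro bexI[of _ "g \<circ> f"]) (auto intro: unimodular_transvection_group_comp)
qed

text \<open>The transvection along \<open>y - x\<close> adds a multiple of \<open>y - x\<close> to \<open>x\<close>. The multiple is
  \<open>a * h (y - x) x = - a * h x y\<close>, which the right choice of \<open>a\<close> makes \<open>1\<close>. The vector \<open>x\<close> itself
  witnesses that \<open>y - x\<close> is unimodular.\<close>

lemma reachable_by_transvection:
  assumes unit: "h x y dvd 1" and orth: "y - x \<in> orth E"
  shows "reachable E x y"
proof -
  obtain c where c: "h x y * c = 1" using unit by (auto simp: dvd_def)
  let ?t = "transvection s h (- c) (y - x)"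
  have yx: "h (y - x) x = - h x y" using form_skew[of y x] by (simp add: form_simps)
  then have "h (y - x) x dvd 1" using unit by simp
  then have "?t \<in> unimodular_transvection_group"
    unfolding unimodular_transvection_group_def by (blast intro: generate.incl)
  moreover have "?t e = e" if "e \<in> E" for e
    using that orth by (simp add: transvection_def orth_def)
  moreover have "?t x = y"
    using c by (simp add: transvection_def yx mult.commute)
  ultimately show ?thesis unfolding reachable_def by blast
qed

end

section \<open>Transitivity on hyperbolic pairs over a local ring\<close>

locale local_alternating_module = alternating_module +
  assumes local: "local_ring TYPE('a)"
begin

text \<open>It suffices to find \<open>z\<close> orthogonal to \<open>E\<close> that pairs to a unit with both \<open>x\<close> and \<open>x'\<close>, and then
  to go from \<open>x\<close> to \<open>z\<close> and on to \<open>x'\<close>. If neither \<open>y\<close> nor \<open>y'\<close> is such a vector, their sum is, as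
  each of its two pairings is a unit plus a nonunit.\<close>

lemma reachable_unimodular:
  assumes "x \<in> orth E" "y \<in> orth E" "x' \<in> orth E" "y' \<in> orth E"
    and xy: "h x y dvd 1" and xy': "h x' y' dvd 1"
  shows "reachable E x x'"
proof -
  have "\<exists>z\<in>orth E. h x z dvd 1 \<and> h x' z dvd 1"
  proof (cases "h x y' dvd 1 \<or> h x' y dvd 1")
    case True
    then show ?thesis using assms by blast
  next
    case False
    have "h x (y + y') dvd 1"
      using local_ring_unit_add[OF local, of "h x (y + y')" "- h x y'"] False xy
      by (simp add: form_simps)
    moreover have "h x' (y + y') dvd 1"
      using local_ring_unit_add[OF local, of "h x' (y + y')" "- h x' y"] False xy'
      by (simp add: form_simps)
    moreover have "y + y' \<in> orth E" using assms by (simp add: orth_def form_simps)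
    ultimately show ?thesis by blast
  qed
  then obtain z where z: "z \<in> orth E" "h x z dvd 1" "h x' z dvd 1" by blast
  then have "h z x' dvd 1" using form_skew[of z x'] by simp
  with z assms show ?thesis
    by (intro reachable_trans[of E x z x'] reachable_by_transvection)
       (auto simp: orth_def form_simps)
qed

text \<open>Here \<open>x\<close> has to stay fixed, so every step must be along a vector orthogonal to \<open>x\<close>. The direct
  step qualifies because \<open>h x (y' - y) = 1 - 1 = 0\<close>. If \<open>h y y'\<close> is not a unit, the detour goes through
  \<open>y + x\<close>: this again pairs to \<open>1\<close> with \<open>x\<close>, it satisfies \<open>h y (y + x) = - 1\<close>, and
  \<open>h (y + x) y' = h y y' + 1\<close> is a unit.\<close>

lemma reachable_second_vector:
  assumes "x \<in> orth E" "y \<in> orth E" "y' \<in> orth E" and xy: "h x y = 1" and xy': "h x y' = 1"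
  shows "reachable (insert x E) y y'"
proof (cases "h y y' dvd 1")
  case True
  then show ?thesis
    using assms form_skew[of y x] form_skew[of y' x]
    by (intro reachable_by_transvection) (auto simp: orth_def form_simps)
next
  case False
  have "h (y + x) y' dvd 1"
    using local_ring_unit_add[OF local, of "h (y + x) y'" "- h y y'"] False xy'
    by (simp add: form_simps)
  moreover have "h y (y + x) dvd 1"
    using form_skew[of y x] xy by (simp add: form_simps)
  ultimately show ?thesis
    using assms form_skew[of y x] form_skew[of y' x]
    by (intro reachable_trans[of _ y "y + x" y'] reachable_by_transvection)
       (auto simp: orth_def form_simps)
qed

lemma hyperbolic_pair_transitive:
  assumes "x \<in> orth E" "y \<in> orth E" "x' \<in> orth E" "y' \<in> orth E" "h x y = 1" "h x' y' = 1"
  obtains t where "t \<in> unimodular_transvection_group" "\<And>e. e \<in> E \<Longrightarrow> t e = e" "t x = x'" "t y = y'"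
proof -
  obtain f where f: "f \<in> unimodular_transvection_group" "\<forall>e\<in>E. f e = e" "f x = x'"
    using reachable_unimodular[of x E y x' y'] assms unfolding reachable_def by auto
  have f_form: "h (f v) (f w) = h v w" for v w
    using f(1) unimodular_transvection_group_subset by (auto simp: symplectic_group_def)
  have "h x' (f y) = 1" using f_form[of x y] f(3) assms by simp
  moreover have "f y \<in> orth E"
    using f unimodular_transvection_group_subset assms(2)
    by (blast intro: fixing_isometry_preserves_orth)
  ultimately obtain g where "g \<in> unimodular_transvection_group" "\<forall>e\<in>insert x' E. g e = e" "g (f y) = y'"
    using reachable_second_vector[of x' E "f y" y'] assms unfolding reachable_def by auto
  with f show thesis
    by (intro that[of "g \<circ> f"]) (auto intro: unimodular_transvection_group_comp)
qed

section \<open>Generation of the symplectic group\<close>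

text \<open>Downward induction on the number \<open>k\<close> of hyperbolic pairs that \<open>g\<close> fixes. The images of the next
  pair under \<open>g\<close> are orthogonal to the pairs already fixed, so transitivity provides a group element
  \<open>t\<close> that moves them back to \<open>u k\<close> and \<open>v k\<close> without disturbing those pairs, and \<open>t \<circ> g\<close> fixes one
  pair more.\<close>

lemma symplectic_group_subset_unimodular_transvection_group:
  assumes sb: "symplectic_basis s h m u v"
  shows "symplectic_group s h \<subseteq> unimodular_transvection_group"
proof
  have basis: "span (u ` {..<m} \<union> v ` {..<m}) = UNIV"
  proof -
    have "set (concat (map (\<lambda>i. [u i, v i]) [0..<m])) = u ` {..<m} \<union> v ` {..<m}"
      by auto
    then show ?thesis using sb by (simp add: symplectic_basis_def ordered_basis_def is_basis_def)
  qed
  have form: "h (u i) (v j) = (if i = j then 1 else 0)" "h (v j) (u i) = (if i = j then -1 else 0)"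
    "h (u i) (u j) = 0" "h (v i) (v j) = 0" if "i < m" "j < m" for i j
    using sb that form_skew[of "v j" "u i"] by (auto simp: symplectic_basis_def)
  interpret G: group "GL s" by (rule group_GL)
  have *: "g \<in> unimodular_transvection_group"
    if "k \<le> m" "g \<in> symplectic_group s h" "\<And>i. i < k \<Longrightarrow> g (u i) = u i \<and> g (v i) = v i" for k g
    using that
  proof (induction k arbitrary: g rule: inc_induct)
    case base
    interpret g: Modules.module_hom s s g using base by (simp add: symplectic_group_def GL_def)
    have "x \<in> span (u ` {..<m} \<union> v ` {..<m}) \<Longrightarrow> g x = id x" for x
      by (rule module_pair.module_hom_eq_on_span[OF _ g.module_hom_axioms module_hom_id])
         (use base module_axioms in \<open>auto simp: module_pair_def\<close>)
    then have "g = id" using basis by auto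
    moreover have "id \<in> unimodular_transvection_group"
      using subgroup.one_closed[OF subgroup_unimodular_transvection_group] by (simp add: GL_def)
    ultimately show ?case by (simp only:)
  next
    case (step k)
    define E where "E = u ` {..<k} \<union> v ` {..<k}"
    have g_form: "h (g x) (g y) = h x y" for x y
      using step.prems(1) by (simp add: symplectic_group_def)
    have E: "u k \<in> orth E" "v k \<in> orth E"
      using step.hyps by (auto simp: E_def orth_def form)
    have "\<forall>e\<in>E. g e = e" using step.prems(2) by (auto simp: E_def)
    then have gE: "g x \<in> orth E" if "x \<in> orth E" for x
      using that step.prems(1) by (blast intro: fixing_isometry_preserves_orth)
    obtain t where t: "t \<in> unimodular_transvection_group" "\<And>e. e \<in> E \<Longrightarrow> t e = e"
      "t (g (u k)) = u k" "t (g (v k)) = v k"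
      using hyperbolic_pair_transitive[of "g (u k)" E "g (v k)" "u k" "v k"] E gE g_form form step.hyps
      by auto
    have t': "t \<in> carrier (GL s)" "g \<in> carrier (GL s)" "t \<in> symplectic_group s h"
      using t(1) unimodular_transvection_group_subset step.prems(1) by (auto simp: symplectic_group_def)
    have "t \<circ> g \<in> unimodular_transvection_group"
    proof (rule step.IH)
      show "t \<circ> g \<in> symplectic_group s h"
        using subgroup.m_closed[OF subgroup_symplectic_group t'(3) step.prems(1)] by (simp add: GL_def)
      show "(t \<circ> g) (u i) = u i \<and> (t \<circ> g) (v i) = v i" if "i < Suc k" for i
        using that t(2-4) step.prems(2)[of i] by (cases "i = k") (auto simp: E_def)
    qed
    then have "t \<otimes>\<^bsub>GL s\<^esub> g \<in> unimodular_transvection_group" by (simp add: GL_def)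
    then have "inv\<^bsub>GL s\<^esub> t \<otimes>\<^bsub>GL s\<^esub> (t \<otimes>\<^bsub>GL s\<^esub> g) \<in> unimodular_transvection_group"
      using subgroup_unimodular_transvection_group t(1)
      by (blast intro: subgroup.m_closed subgroup.m_inv_closed)
    then show ?case using t' by (simp add: G.m_assoc[symmetric])
  qed
  show "g \<in> unimodular_transvection_group" if "g \<in> symplectic_group s h" for g
    using *[of 0 g] that by simp
qed

text \<open>Some automorphism carries the basis vector \<open>u 0\<close> to \<open>x\<close>, hence a basis through \<open>u 0\<close> to one
  through \<open>x\<close>.\<close>

lemma basis_vector_if_unimodular:
  assumes sb: "symplectic_basis s h m u v" and "m \<ge> 1" and unit: "h x y dvd 1"
  shows "basis_vector s x"
proof -
  define B where "B = set (concat (map (\<lambda>i. [u i, v i]) [0..<m]))"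
  have B: "is_basis s B" "u 0 \<in> B"
    using sb \<open>m \<ge> 1\<close> by (auto simp: symplectic_basis_def ordered_basis_def B_def)
  have "h (u 0) (v 0) = 1" using sb \<open>m \<ge> 1\<close> by (simp add: symplectic_basis_def)
  then obtain t where "t \<in> unimodular_transvection_group" "t (u 0) = x"
    using reachable_unimodular[of "u 0" "{}" "v 0" x y] unit
    by (auto simp: orth_def reachable_def)
  moreover from this have "t \<in> carrier (GL s)"
    using unimodular_transvection_group_subset by (auto simp: symplectic_group_def)
  ultimately show ?thesis
    using is_basis_image[of t B] B unfolding basis_vector_def by blast
qed

end

theorem theorem9p15:
  fixes s :: "'a::comm_ring_1 \<Rightarrow> 'v::ab_group_add \<Rightarrow> 'v"
    and h :: "'v \<Rightarrow> 'v \<Rightarrow> 'a"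
    and m :: nat
  assumes "local_ring TYPE('a)"
    and "m \<ge> 1"
    and "free_of_rank s (2 * m)"
    and "alternating_form s h"
    and "nondegenerate s h"
    and "\<exists>u v. symplectic_basis s h m u v"
  shows "unitary_group s h = symplectic_group s h
    \<and> symplectic_group s h = special_unitary_group s h
    \<and> generate (GL s) {transvection s h a v | a v. basis_vector s v} = symplectic_group s h
    \<and> (\<forall>g \<in> symplectic_group s h. endo_det s g = 1)"
proof -
  interpret Modules.module s using assms(3) by (simp add: free_of_rank_def)
  interpret local_alternating_module s h by unfold_locales (fact assms)+
  interpret G: group "GL s" by (rule group_GL)
  let ?T = "{transvection s h a v | a v. basis_vector s v}"
  obtain u v where sb: "symplectic_basis s h m u v" using assms(6) by blast
  have U: "unitary_group s h = symplectic_group s h"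
    by (simp add: unitary_group_def symplectic_group_def)
  have "unimodular_transvection_group \<subseteq> generate (GL s) ?T"
    unfolding unimodular_transvection_group_def
    using basis_vector_if_unimodular[OF sb assms(2)] by (intro G.mono_generate) blast
  moreover have "generate (GL s) ?T \<subseteq> symplectic_group s h"
    using transvection_in_symplectic_group
    by (intro G.generate_subgroup_incl subgroup_symplectic_group) auto
  ultimately have gen: "generate (GL s) ?T = symplectic_group s h"
    using symplectic_group_subset_unimodular_transvection_group[OF sb] by blast
  have det: "endo_det s g = 1" if g: "g \<in> symplectic_group s h" for g
  proof -
    have all: "det (matrix_of s bs g) = 1" if bs: "ordered_basis s bs" for bs
    proof -
      have "?T \<subseteq> {g \<in> carrier (GL s). det (matrix_of s bs g) = 1}"
        using transvection_in_symplectic_group det_transvection[OF bs]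
        by (auto simp: symplectic_group_def)
      from G.generate_subgroup_incl[OF this subgroup_det_eq_1[OF bs]] g gen show ?thesis by blast
    qed
    obtain bs where bs: "ordered_basis s bs" using sb by (auto simp: symplectic_basis_def)
    show ?thesis
      unfolding endo_det_def
      by (rule the_equality) (use all bs in \<open>force+\<close>)
  qed
  with U gen show ?thesis by (auto simp: special_unitary_group_def)
qed

end
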